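(* Let $K$ be a field, let $E=K\langle e_1,\ldots,e_n\rangle$ be the exterior algebra of a $K$-vector space with basis $e_1,\ldots,e_n$, let $I\subsetneq E$ be a nonzero strongly stable ideal, and let $J$ be the colexsegment ideal associated to $I$, where $n$ is assumed sufficiently large that $J$ can be constructed in $E$. Then for all integers $t\ge \mathrm{indeg}(I)$ and all integers $p$ with $t\le p\le n$, $$\mathrm{m}_{\le p}(\mathrm{Mon}(I_t))\le \mathrm{m}_{\le p}(\mathrm{Mon}(J_t)).$$
   Context: For $\sigma=\{i_1<\cdots<i_d\}\subseteq\{1,\ldots,n\}$ write $e_\sigma=e_{i_1}\wedge\cdots\wedge e_{i_d}$ (and $e_\emptyset=1$); $e_\sigma$ is called a monomial of degree $d$, and for $\sigma\neq\emptyset$ put $\mathrm{m}(e_\sigma)=\max\sigma$. $E_j$ is the degree $j$ component of $E$. A monomial ideal is an ideal generated by monomials. For a graded ideal $I=\bigoplus_j I_j$, $\mathrm{indeg}(I)$ is the minimum $s$ with $I_s\ne0$. $\mathrm{Mon}(S)$ denotes the set of all monomials in a subset $S\subseteq E$ and $\mathrm{Mon}_d(E)$ the set of monomials of degree $d$ in $E$. For a set $M$ of monomials, $M_{\le p}=\{u\in M:\mathrm{m}(u)\le p\}$ and $\mathrm{m}_{\le p}(M)=|M_{\le p}|$. A monomial ideal $I$ of $E$ is strongly stable if for each monomial $e_\sigma\in I$, each $j\in\sigma$ and each $i<j$ one has $e_i\wedge e_{\sigma\setminus\{j\}}\in I$. Reverse lexicographic order on $\mathrm{Mon}_d(E)$: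 for $e_\sigma=e_{i_1}\cdots e_{i_d}$ and $e_\tau=e_{j_1}\cdots e_{j_d}$ with increasing indices, $e_\sigma>_{\mathrm{revlex}}e_\tau$ if for some $1\le s\le d$ one has $i_d=j_d,\ldots,i_{s+1}=j_{s+1}$ and $i_s<j_s$. Colexsegment ideal associated to $I$: let $1\le d_1<\cdots<d_r\le n$ be the degrees of the minimal monomial generators of $I$, and let $p_j$ be the number of minimal monomial generators of $I$ of degree $d_j$. The monomial ideal $J$ is constructed degree by degree: for $j=1,\ldots,r$, the minimal generators of $J$ of degree $d_j$ are the $p_j$ largest monomials of degree $d_j$ in the reverse lexicographic order that do not lie in $E_1J_{d_j-1}$, where $J_{d_j-1}$ is the degree $d_j-1$ component of the ideal generated by the generators already chosen (it is $0$ for $j=1$). In general this may require more variables than $n$; the standing assumption is that $n$ is large enough for the construction to be carried out in $E$, i.e. enough monomials are available in each degree $d_j$. *)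

theory Defs
  imports "HOL-Algebra.Ideal_Product"
begin

text \<open>
  The exterior algebra \<open>K\<langle>e\<^sub>1,\<dots>,e\<^sub>n\<rangle>\<close> in coordinates with respect to the basis
  \<open>(e\<^sub>\<sigma>)\<close>, \<open>\<sigma> \<subseteq> {1..n}\<close>: the function \<open>f\<close> stands for the sum of the \<open>f \<sigma> \<cdot> e\<^sub>\<sigma>\<close>.
  For disjoint \<open>\<sigma>\<close> and \<open>\<tau>\<close> one has
  \<open>e\<^sub>\<sigma> \<and> e\<^sub>\<tau> = (-1)\<^sup>k e\<^bsub>\<sigma> \<union> \<tau>\<^esub>\<close>, where \<open>k\<close> is the number of pairs \<open>(i, j) \<in> \<sigma> \<times> \<tau>\<close> with \<open>j < i\<close>,
  and \<open>e\<^sub>\<sigma> \<and> e\<^sub>\<tau> = 0\<close> otherwise (lemma \<open>wedge_emon\<close>).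
\<close>

definition wedge_sign :: "nat set \<Rightarrow> nat set \<Rightarrow> 'k::field" where
  "wedge_sign \<sigma> \<tau> = (-1) ^ card {(i, j). i \<in> \<sigma> \<and> j \<in> \<tau> \<and> j < i}"

definition wedge :: "(nat set \<Rightarrow> 'k::field) \<Rightarrow> (nat set \<Rightarrow> 'k) \<Rightarrow> nat set \<Rightarrow> 'k" where
  "wedge f g = (\<lambda>\<rho>. \<Sum>\<sigma>\<in>Pow \<rho>. wedge_sign \<sigma> (\<rho> - \<sigma>) * f \<sigma> * g (\<rho> - \<sigma>))"

definition emon :: "nat set \<Rightarrow> nat set \<Rightarrow> 'k::field" where
  "emon \<sigma> = (\<lambda>\<rho>. if \<rho> = \<sigma> then 1 else 0)"

definition ext_alg :: "nat \<Rightarrow> (nat set \<Rightarrow> 'k::field) ring" where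
  "ext_alg n =
    \<lparr> carrier = {f. \<forall>\<sigma>. f \<sigma> \<noteq> 0 \<longrightarrow> \<sigma> \<subseteq> {1..n}},
      monoid.mult = wedge,
      one = emon {},
      zero = (\<lambda>_. 0),
      add = (\<lambda>f g \<sigma>. f \<sigma> + g \<sigma>) \<rparr>"

lemma wedge_sign_Un_left:
  assumes "finite \<sigma>" "finite \<tau>" "finite \<rho>" "\<sigma> \<inter> \<tau> = {}"
  shows "wedge_sign (\<sigma> \<union> \<tau>) \<rho> = (wedge_sign \<sigma> \<rho> * wedge_sign \<tau> \<rho> :: 'k::field)"
proof -
  have eq: "{(i, j). i \<in> \<sigma> \<union> \<tau> \<and> j \<in> \<rho> \<and> j < i} =
      {(i, j). i \<in> \<sigma> \<and> j \<in> \<rho> \<and> j < i} \<union> {(i, j). i \<in> \<tau> \<and> j \<in> \<rho> \<and> j < i}" by auto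
  have "finite {(i, j). i \<in> \<sigma> \<and> j \<in> \<rho> \<and> j < i}" "finite {(i, j). i \<in> \<tau> \<and> j \<in> \<rho> \<and> j < i}"
    by (rule finite_subset[of _ "\<sigma> \<times> \<rho>"] finite_subset[of _ "\<tau> \<times> \<rho>"]; use assms in auto)+
  then show ?thesis
    unfolding wedge_sign_def eq using assms(4)
    by (subst card_Un_disjoint) (auto simp: power_add)
qed

lemma wedge_sign_Un_right:
  assumes "finite \<sigma>" "finite \<tau>" "finite \<rho>" "\<sigma> \<inter> \<tau> = {}"
  shows "wedge_sign \<rho> (\<sigma> \<union> \<tau>) = (wedge_sign \<rho> \<sigma> * wedge_sign \<rho> \<tau> :: 'k::field)"
proof -
  have eq: "{(i, j). i \<in> \<rho> \<and> j \<in> \<sigma> \<union> \<tau> \<and> j < i} =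
      {(i, j). i \<in> \<rho> \<and> j \<in> \<sigma> \<and> j < i} \<union> {(i, j). i \<in> \<rho> \<and> j \<in> \<tau> \<and> j < i}" by auto
  have "finite {(i, j). i \<in> \<rho> \<and> j \<in> \<sigma> \<and> j < i}" "finite {(i, j). i \<in> \<rho> \<and> j \<in> \<tau> \<and> j < i}"
    by (rule finite_subset[of _ "\<rho> \<times> \<sigma>"] finite_subset[of _ "\<rho> \<times> \<tau>"]; use assms in auto)+
  then show ?thesis
    unfolding wedge_sign_def eq using assms(4)
    by (subst card_Un_disjoint) (auto simp: power_add)
qed

lemma wedge_sign_empty [simp]: "wedge_sign {} \<sigma> = 1" "wedge_sign \<sigma> {} = 1"
  by (simp_all add: wedge_sign_def)

lemma wedge_infinite: "infinite \<rho> \<Longrightarrow> wedge f g \<rho> = 0"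
  by (simp add: wedge_def)

lemma wedge_assoc: "wedge (wedge f g) h = wedge f (wedge g h)"
proof
  fix \<rho> :: "nat set"
  show "wedge (wedge f g) h \<rho> = wedge f (wedge g h) \<rho>"
  proof (cases "finite \<rho>")
    case False
    then show ?thesis by (simp add: wedge_infinite)
  next
    case fin: True
    have "wedge (wedge f g) h \<rho> = (\<Sum>\<sigma>\<in>Pow \<rho>. \<Sum>\<tau>\<in>Pow \<sigma>.
        wedge_sign \<sigma> (\<rho> - \<sigma>) * wedge_sign \<tau> (\<sigma> - \<tau>) * f \<tau> * g (\<sigma> - \<tau>) * h (\<rho> - \<sigma>))"
      unfolding wedge_def by (simp add: sum_distrib_left sum_distrib_right mult.assoc)
    also have "\<dots> = (\<Sum>(\<sigma>, \<tau>)\<in>(SIGMA \<sigma>:Pow \<rho>. Pow \<sigma>).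
        wedge_sign \<sigma> (\<rho> - \<sigma>) * wedge_sign \<tau> (\<sigma> - \<tau>) * f \<tau> * g (\<sigma> - \<tau>) * h (\<rho> - \<sigma>))"
      by (rule sum.Sigma) (use fin in \<open>auto intro: finite_subset\<close>)
    also have "\<dots> = (\<Sum>(\<tau>, \<upsilon>)\<in>(SIGMA \<tau>:Pow \<rho>. Pow (\<rho> - \<tau>)).
        wedge_sign \<tau> (\<rho> - \<tau>) * wedge_sign \<upsilon> (\<rho> - \<tau> - \<upsilon>) * f \<tau> * g \<upsilon> * h (\<rho> - \<tau> - \<upsilon>))"
    proof (rule sum.reindex_bij_witness[where
          i = "\<lambda>(\<tau>, \<upsilon>). (\<tau> \<union> \<upsilon>, \<tau>)" and j = "\<lambda>(\<sigma>, \<tau>). (\<tau>, \<sigma> - \<tau>)"], goal_cases)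
      case (5 a)
      obtain \<sigma> \<tau> where a: "a = (\<sigma>, \<tau>)" by (cases a)
      with 5 have sub: "\<sigma> \<subseteq> \<rho>" "\<tau> \<subseteq> \<sigma>" by auto
      then have f: "finite \<sigma>" "finite \<tau>" using fin by (auto intro: finite_subset)
      define \<upsilon> where "\<upsilon> = \<sigma> - \<tau>"
      define \<omega> where "\<omega> = \<rho> - \<sigma>"
      have *: "\<sigma> = \<tau> \<union> \<upsilon>" "\<rho> - \<tau> = \<upsilon> \<union> \<omega>" "\<rho> - \<tau> - \<upsilon> = \<omega>" "\<tau> \<inter> \<upsilon> = {}" "\<upsilon> \<inter> \<omega> = {}"
        using sub by (auto simp: \<upsilon>_def \<omega>_def)
      have "finite \<upsilon>" "finite \<omega>" using f fin by (auto simp: \<upsilon>_def \<omega>_def)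
      then have "wedge_sign \<sigma> \<omega> * wedge_sign \<tau> \<upsilon> =
          (wedge_sign \<tau> (\<rho> - \<tau>) * wedge_sign \<upsilon> \<omega> :: 'a)"
        using * f by (simp add: wedge_sign_Un_left wedge_sign_Un_right mult_ac)
      then show ?case
        using *(3) by (simp add: a flip: \<upsilon>_def \<omega>_def)
    qed auto
    also have "\<dots> = (\<Sum>\<tau>\<in>Pow \<rho>. \<Sum>\<upsilon>\<in>Pow (\<rho> - \<tau>).
        wedge_sign \<tau> (\<rho> - \<tau>) * wedge_sign \<upsilon> (\<rho> - \<tau> - \<upsilon>) * f \<tau> * g \<upsilon> * h (\<rho> - \<tau> - \<upsilon>))"
      by (rule sum.Sigma[symmetric]) (use fin in \<open>auto intro: finite_subset\<close>)
    also have "\<dots> = wedge f (wedge g h) \<rho>"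
      unfolding wedge_def by (simp add: sum_distrib_left mult_ac)
    finally show ?thesis .
  qed
qed

lemma wedge_emon:
  assumes "finite \<sigma>" "finite \<tau>"
  shows "wedge (emon \<sigma>) (emon \<tau>) =
    (if \<sigma> \<inter> \<tau> = {} then (\<lambda>\<rho>. wedge_sign \<sigma> \<tau> * emon (\<sigma> \<union> \<tau>) \<rho>) else (\<lambda>_. 0 :: 'k::field))"
proof
  fix \<rho> :: "nat set"
  have 1: "wedge (emon \<sigma>) (emon \<tau>) \<rho> = (if \<sigma> \<subseteq> \<rho> \<and> finite \<rho> \<and> \<rho> - \<sigma> = \<tau> then wedge_sign \<sigma> \<tau> else 0 :: 'k)"
  proof (cases "finite \<rho>")
    case True
    have "wedge (emon \<sigma>) (emon \<tau>) \<rho> =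
        (\<Sum>\<sigma>'\<in>Pow \<rho>. if \<sigma> = \<sigma>' then wedge_sign \<sigma> (\<rho> - \<sigma>) * emon \<tau> (\<rho> - \<sigma>) else 0 :: 'k)"
      unfolding wedge_def by (rule sum.cong) (auto simp: emon_def)
    then show ?thesis using True by (auto simp: sum.delta emon_def)
  qed (simp add: wedge_infinite)
  show "wedge (emon \<sigma>) (emon \<tau>) \<rho> =
    (if \<sigma> \<inter> \<tau> = {} then (\<lambda>\<rho>. wedge_sign \<sigma> \<tau> * emon (\<sigma> \<union> \<tau>) \<rho>) else (\<lambda>_. 0 :: 'k)) \<rho>"
  proof (cases "\<sigma> \<inter> \<tau> = {}")
    case True
    then have "(\<sigma> \<subseteq> \<rho> \<and> finite \<rho> \<and> \<rho> - \<sigma> = \<tau>) \<longleftrightarrow> \<rho> = \<sigma> \<union> \<tau>" using assms by auto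
    then show ?thesis using True unfolding 1 by (simp add: emon_def)
  next
    case False
    then have "\<not> (\<sigma> \<subseteq> \<rho> \<and> finite \<rho> \<and> \<rho> - \<sigma> = \<tau>)" by auto
    then show ?thesis using False by (simp only: 1 if_False)
  qed
qed

lemma ring_ext_alg: "ring (ext_alg n :: (nat set \<Rightarrow> 'k::field) ring)"
proof (rule ringI)
  let ?E = "ext_alg n :: (nat set \<Rightarrow> 'k) ring"
  show "abelian_group ?E"
  proof (rule abelian_groupI)
    fix x y assume xy: "x \<in> carrier ?E" "y \<in> carrier ?E"
    have "\<sigma> \<subseteq> {1..n}" if "x \<sigma> + y \<sigma> \<noteq> 0" for \<sigma>
      using that xy by (cases "x \<sigma> = 0") (auto simp: ext_alg_def)
    then show "x \<oplus>\<^bsub>?E\<^esub> y \<in> carrier ?E" by (auto simp: ext_alg_def)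
  next
    fix x assume "x \<in> carrier ?E"
    then show "\<exists>y\<in>carrier ?E. y \<oplus>\<^bsub>?E\<^esub> x = \<zero>\<^bsub>?E\<^esub>"
      by (intro bexI[of _ "\<lambda>\<sigma>. - x \<sigma>"]) (auto simp: ext_alg_def)
  qed (auto simp: ext_alg_def add_ac)
  show "monoid ?E"
  proof (rule monoidI)
    fix x y assume xy: "x \<in> carrier ?E" "y \<in> carrier ?E"
    have "\<rho> \<subseteq> {1..n}" if nz: "wedge x y \<rho> \<noteq> 0" for \<rho>
    proof -
      obtain \<sigma> where "\<sigma> \<in> Pow \<rho>" "wedge_sign \<sigma> (\<rho> - \<sigma>) * x \<sigma> * y (\<rho> - \<sigma>) \<noteq> 0"
        using nz unfolding wedge_def by (rule sum.not_neutral_contains_not_neutral)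
      then have "x \<sigma> \<noteq> 0" "y (\<rho> - \<sigma>) \<noteq> 0" by auto
      then have "\<sigma> \<subseteq> {1..n}" "\<rho> - \<sigma> \<subseteq> {1..n}" using xy by (auto simp: ext_alg_def)
      then show ?thesis by blast
    qed
    then show "x \<otimes>\<^bsub>?E\<^esub> y \<in> carrier ?E" unfolding ext_alg_def by simp
  next
    fix x assume x: "x \<in> carrier ?E"
    have fin: "x \<rho> = 0" if "infinite \<rho>" for \<rho>
      using x that by (auto simp: ext_alg_def dest: finite_subset)
    have "wedge (emon {}) x \<rho> = x \<rho>" for \<rho>
    proof (cases "finite \<rho>")
      case True
      have "wedge (emon {}) x \<rho> = (\<Sum>\<sigma>\<in>Pow \<rho>. if {} = \<sigma> then x \<rho> else 0)"
        unfolding wedge_def by (rule sum.cong) (auto simp: emon_def)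
      then show ?thesis using True by (simp add: sum.delta)
    qed (simp add: wedge_infinite fin)
    then show "\<one>\<^bsub>?E\<^esub> \<otimes>\<^bsub>?E\<^esub> x = x" by (auto simp: ext_alg_def)
    have "wedge x (emon {}) \<rho> = x \<rho>" for \<rho>
    proof (cases "finite \<rho>")
      case True
      have "wedge x (emon {}) \<rho> = (\<Sum>\<sigma>\<in>Pow \<rho>. if \<rho> = \<sigma> then x \<rho> else 0)"
        unfolding wedge_def by (rule sum.cong) (auto simp: emon_def)
      then show ?thesis using True by (simp add: sum.delta)
    qed (simp add: wedge_infinite fin)
    then show "x \<otimes>\<^bsub>?E\<^esub> \<one>\<^bsub>?E\<^esub> = x" by (auto simp: ext_alg_def)
  qed (auto simp: ext_alg_def emon_def wedge_assoc split: if_splits)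
qed (auto simp: ext_alg_def wedge_def fun_eq_iff distrib_left distrib_right sum.distrib)

text \<open>
  Monomials are represented by their index sets: \<open>Mon n S\<close> consists of the \<open>\<sigma>\<close> with \<open>e\<^sub>\<sigma> \<in> S\<close>.
  Thus the degree of a monomial is \<open>card \<sigma>\<close>, and \<open>m(e\<^sub>\<sigma>)\<close> is \<open>Max \<sigma>\<close> for \<open>\<sigma> \<noteq> {}\<close>.
\<close>

definition Mon :: "nat \<Rightarrow> (nat set \<Rightarrow> 'k::field) set \<Rightarrow> nat set set" where
  "Mon n S = {\<sigma>. \<sigma> \<subseteq> {1..n} \<and> emon \<sigma> \<in> S}"

definition Mon_deg :: "nat \<Rightarrow> nat \<Rightarrow> nat set set" where
  "Mon_deg n d = {\<sigma>. \<sigma> \<subseteq> {1..n} \<and> card \<sigma> = d}"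

definition m_le :: "nat \<Rightarrow> nat set set \<Rightarrow> nat" where
  "m_le p M = card {\<sigma> \<in> M. Max \<sigma> \<le> p}"

definition homog_part :: "(nat set \<Rightarrow> 'k::field) set \<Rightarrow> nat \<Rightarrow> (nat set \<Rightarrow> 'k) set" where
  "homog_part S d = {f \<in> S. \<forall>\<sigma>. f \<sigma> \<noteq> 0 \<longrightarrow> card \<sigma> = d}"

definition indeg :: "(nat set \<Rightarrow> 'k::field) set \<Rightarrow> nat" where
  "indeg I = (LEAST s. homog_part I s \<noteq> {\<lambda>_. 0})"

definition mon_ideal :: "nat \<Rightarrow> nat set set \<Rightarrow> (nat set \<Rightarrow> 'k::field) set" where
  "mon_ideal n M = genideal (ext_alg n) (emon ` M)"

definition is_monomial_ideal :: "nat \<Rightarrow> (nat set \<Rightarrow> 'k::field) set \<Rightarrow> bool" where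
  "is_monomial_ideal n I \<longleftrightarrow> (\<exists>M \<subseteq> Pow {1..n}. I = mon_ideal n M)"

definition strongly_stable :: "nat \<Rightarrow> (nat set \<Rightarrow> 'k::field) set \<Rightarrow> bool" where
  "strongly_stable n I \<longleftrightarrow> is_monomial_ideal n I \<and>
    (\<forall>\<sigma> \<in> Mon n I. \<forall>j \<in> \<sigma>. \<forall>i \<in> {1..<j}. emon {i} \<otimes>\<^bsub>ext_alg n\<^esub> emon (\<sigma> - {j}) \<in> I)"

definition minimal_mon_gens :: "nat \<Rightarrow> (nat set \<Rightarrow> 'k::field) set \<Rightarrow> nat set set \<Rightarrow> bool" where
  "minimal_mon_gens n I M \<longleftrightarrow> M \<subseteq> Pow {1..n} \<and> mon_ideal n M = I \<and>
    (\<forall>M'. M' \<subset> M \<longrightarrow> mon_ideal n M' \<noteq> I)"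

text \<open>\<open>revlex_gt \<sigma> \<tau>\<close> means \<open>e\<^sub>\<sigma> > e\<^sub>\<tau>\<close>, for monomials of the same degree. List positions start at 0.\<close>

definition revlex_gt :: "nat set \<Rightarrow> nat set \<Rightarrow> bool" where
  "revlex_gt \<sigma> \<tau> \<longleftrightarrow>
    (let is = sorted_list_of_set \<sigma>; js = sorted_list_of_set \<tau> in
      length is = length js \<and>
      (\<exists>s < length is. (\<forall>k. s < k \<and> k < length is \<longrightarrow> is ! k = js ! k) \<and> is ! s < js ! s))"

definition largest_revlex :: "nat \<Rightarrow> nat set set \<Rightarrow> nat set set \<Rightarrow> bool" where
  "largest_revlex p A L \<longleftrightarrow>
    L \<subseteq> A \<and> finite L \<and> card L = p \<and> (\<forall>\<sigma> \<in> L. \<forall>\<tau> \<in> A - L. revlex_gt \<sigma> \<tau>)"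

text \<open>
  \<open>colex_steps TYPE('k) n p ds G H\<close>: starting from the generators \<open>G\<close>, the construction can be carried
  out in \<open>ext_alg n\<close> for the degrees in the list \<open>ds\<close>, choosing \<open>p d\<close> new generators in degree \<open>d\<close>,
  and it ends with the generators \<open>H\<close>. The product \<open>\<cdot>\<close> is the set of finite sums of
  products, i.e. here the product of linear subspaces. No \<open>H\<close> exists if in some degree fewer than
  \<open>p d\<close> monomials are available.
\<close>

fun colex_steps ::
  "'k::field itself \<Rightarrow> nat \<Rightarrow> (nat \<Rightarrow> nat) \<Rightarrow> nat list \<Rightarrow> nat set set \<Rightarrow> nat set set \<Rightarrow> bool" where
  "colex_steps K n p [] G H \<longleftrightarrow> H = G"
| "colex_steps K n p (d # ds) G H \<longleftrightarrow>
    (let E = ext_alg n :: (nat set \<Rightarrow> 'k) ring;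
         J = mon_ideal n G :: (nat set \<Rightarrow> 'k) set;
         A = Mon_deg n d - Mon n (homog_part (carrier E) 1 \<cdot>\<^bsub>E\<^esub> homog_part J (d - 1))
     in \<exists>L. largest_revlex (p d) A L \<and> colex_steps K n p ds (G \<union> L) H)"

text \<open>
  \<open>colexsegment_ideal n I J\<close> includes the assumption that \<open>n\<close> is large enough: it says that the
  construction can be carried out in \<open>ext_alg n\<close> and yields \<open>J\<close>.
\<close>

definition colexsegment_ideal ::
  "nat \<Rightarrow> (nat set \<Rightarrow> 'k::field) set \<Rightarrow> (nat set \<Rightarrow> 'k) set \<Rightarrow> bool" where
  "colexsegment_ideal n I J \<longleftrightarrow>
    (\<exists>M H. minimal_mon_gens n I M \<and>
       colex_steps TYPE('k) n (\<lambda>d. card {\<sigma> \<in> M. card \<sigma> = d})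
         (sorted_list_of_set (card ` M)) {} H \<and>
       J = mon_ideal n H)"

end

theory Submission
  imports Defs
begin

text \<open>
  A monomial ideal is determined by its monomials, so the theorem is about families of subsets of
  \<open>{1..n}\<close>. Let \<open>A\<^sub>t\<close> and \<open>B\<^sub>t\<close> be the index sets of the monomials of degree \<open>t\<close> in \<open>I\<close> and \<open>J\<close>, and
  let \<open>c\<^sub>p\<close> count the members of a family that are contained in \<open>{1..p}\<close>. The inequality
  \<open>c\<^sub>p(A\<^sub>t) \<le> c\<^sub>p(B\<^sub>t)\<close> holds for all \<open>p \<le> n\<close>, by induction on \<open>t\<close>.

  The family \<open>A\<^bsub>t+1\<^esub>\<close> is the disjoint union of the upper shadow of \<open>A\<^sub>t\<close> (the monomials of
  \<open>E\<^sub>1 I\<^sub>t\<close>) and of the minimal generators of degree \<open>t + 1\<close>; the family \<open>B\<^bsub>t+1\<^esub>\<close> is the upper shadow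
  of \<open>B\<^sub>t\<close> together with as many new generators.

  On shadows, the members with maximum \<open>p + 1\<close> include all \<open>\<sigma> \<union> {p + 1}\<close> with \<open>\<sigma> \<subseteq> {1..p}\<close> in the
  family, and for a strongly stable family there are no others, because any element may be
  exchanged with the maximum. Hence \<open>c\<^bsub>p+1\<^esub>\<close> of the shadow is at least \<open>c\<^sub>p\<close> of the shadow plus \<open>c\<^sub>p\<close>
  of the family, with equality in the strongly stable case, and the inequality passes from
  \<open>A\<^sub>t\<close>, \<open>B\<^sub>t\<close> to their shadows (\<open>count_below_upper_shadow_mono\<close>).

  For the generators there are two cases. If all new generators of \<open>J\<close> lie in \<open>{1..p}\<close>, then they
  contribute to \<open>c\<^sub>p\<close> at least as much as those of \<open>I\<close>. Otherwise one of them has maximum above \<open>p\<close>.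
  It is revlex-smaller than every monomial in the variables up to \<open>p\<close>, and it was chosen
  although only the largest available monomials are; so all those monomials lie in \<open>J\<close>, and
  \<open>c\<^sub>p(B\<^bsub>t+1\<^esub>)\<close> is as large as it can be (\<open>count_below_largest_revlex\<close>).
\<close>

section \<open>Monomials of ideals of the exterior algebra\<close>

definition up_closure :: "nat \<Rightarrow> nat set set \<Rightarrow> nat set set" where
  "up_closure n M = {\<tau>. \<tau> \<subseteq> {1..n} \<and> (\<exists>\<sigma>\<in>M. \<sigma> \<subseteq> \<tau>)}"

definition degree_part :: "nat \<Rightarrow> nat set set \<Rightarrow> nat set set" where
  "degree_part d A = {\<sigma> \<in> A. card \<sigma> = d}"

definition upper_shadow :: "nat \<Rightarrow> nat set set \<Rightarrow> nat set set" where
  "upper_shadow n A = {\<tau>. \<tau> \<subseteq> {1..n} \<and> (\<exists>x\<in>\<tau>. \<tau> - {x} \<in> A)}"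

lemma ext_alg_simps [simp]:
  "f \<otimes>\<^bsub>ext_alg n\<^esub> g = wedge f g"
  "\<one>\<^bsub>ext_alg n\<^esub> = emon {}"
  "\<zero>\<^bsub>ext_alg n\<^esub> = (\<lambda>_. 0)"
  "f \<oplus>\<^bsub>ext_alg n\<^esub> g = (\<lambda>\<sigma>. f \<sigma> + g \<sigma>)"
  by (simp_all add: ext_alg_def)

lemma mem_carrier_ext_alg: "f \<in> carrier (ext_alg n) \<longleftrightarrow> (\<forall>\<sigma>. f \<sigma> \<noteq> 0 \<longrightarrow> \<sigma> \<subseteq> {1..n})"
  by (simp add: ext_alg_def)

lemma emon_in_carrier: "\<sigma> \<subseteq> {1..n} \<Longrightarrow> emon \<sigma> \<in> carrier (ext_alg n)"
  by (simp add: mem_carrier_ext_alg emon_def)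

lemma wedge_nonzeroD:
  assumes "wedge f g \<rho> \<noteq> 0"
  shows "\<exists>\<sigma>\<subseteq>\<rho>. f \<sigma> \<noteq> 0 \<and> g (\<rho> - \<sigma>) \<noteq> 0"
proof -
  obtain \<sigma> where "\<sigma> \<in> Pow \<rho>" "wedge_sign \<sigma> (\<rho> - \<sigma>) * f \<sigma> * g (\<rho> - \<sigma>) \<noteq> 0"
    using assms unfolding wedge_def by (rule sum.not_neutral_contains_not_neutral)
  then show ?thesis by auto
qed

text \<open>
  The sign of a product of monomials is absorbed by rescaling the first factor; it is its own
  inverse.
\<close>

lemma emon_eq_wedge:
  assumes "finite \<tau>" "\<sigma> \<subseteq> \<tau>"
  shows "(emon \<tau> :: nat set \<Rightarrow> 'k::field) =
    wedge (\<lambda>\<rho>. wedge_sign \<sigma> (\<tau> - \<sigma>) * emon \<sigma> \<rho>) (emon (\<tau> - \<sigma>))"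
proof -
  let ?c = "wedge_sign \<sigma> (\<tau> - \<sigma>) :: 'k"
  have "finite \<sigma>" using assms by (rule finite_subset[rotated])
  then have "wedge (emon \<sigma>) (emon (\<tau> - \<sigma>)) = (\<lambda>\<rho>. ?c * emon \<tau> \<rho>)"
    using assms by (subst wedge_emon) (auto simp: Un_absorb1)
  moreover have "wedge (\<lambda>\<rho>. ?c * emon \<sigma> \<rho>) (emon (\<tau> - \<sigma>)) =
      (\<lambda>\<rho>. ?c * wedge (emon \<sigma>) (emon (\<tau> - \<sigma>)) \<rho>)"
    by (simp add: wedge_def sum_distrib_left mult_ac fun_eq_iff)
  moreover have "?c * ?c = 1"
    by (simp add: wedge_sign_def flip: power_add)
  ultimately show ?thesis by (simp add: fun_eq_iff flip: mult.assoc)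
qed

text \<open>
  The upper bound for a generated monomial ideal: elements all of whose terms lie in a given
  family form an ideal as soon as the family is closed under supersets.
\<close>

lemma ideal_supported:
  assumes sub: "U \<subseteq> Pow {1..n}"
    and up: "\<And>\<sigma> \<tau>. \<sigma> \<in> U \<Longrightarrow> \<sigma> \<subseteq> \<tau> \<Longrightarrow> \<tau> \<subseteq> {1..n} \<Longrightarrow> \<tau> \<in> U"
  shows "ideal {f. \<forall>\<tau>. f \<tau> \<noteq> 0 \<longrightarrow> \<tau> \<in> U} (ext_alg n :: (nat set \<Rightarrow> 'k::field) ring)"
    (is "ideal ?S ?E")
proof -
  interpret ring ?E by (rule ring_ext_alg)
  have carr: "?S \<subseteq> carrier ?E" using sub unfolding mem_carrier_ext_alg subset_iff by blast
  show ?thesis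
  proof (rule idealI[OF ring_ext_alg])
    show "subgroup ?S (add_monoid ?E)"
    proof (rule add.subgroupI)
      fix f assume f: "f \<in> ?S"
      then have "(\<lambda>\<tau>. - f \<tau>) \<in> ?S" by auto
      moreover have "\<ominus>\<^bsub>?E\<^esub> f = (\<lambda>\<tau>. - f \<tau>)"
        by (rule minus_equality) (use f calculation carr in auto)
      ultimately show "\<ominus>\<^bsub>?E\<^esub> f \<in> ?S" by simp
    next
      fix f g assume fg: "f \<in> ?S" "g \<in> ?S"
      have "\<tau> \<in> U" if "f \<tau> + g \<tau> \<noteq> 0" for \<tau>
      proof -
        have "f \<tau> \<noteq> 0 \<or> g \<tau> \<noteq> 0" using that by auto
        then show ?thesis using fg by blast
      qed
      then show "f \<oplus>\<^bsub>?E\<^esub> g \<in> ?S" by simp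
    next
      have "(\<lambda>_. 0) \<in> ?S" by simp
      then show "?S \<noteq> {}" by (metis (lifting) equals0D)
    next
      show "?S \<subseteq> carrier ?E" by (rule carr)
    qed
  next
    fix f x assume f: "f \<in> ?S" and x: "x \<in> carrier ?E"
    have supp: "\<tau> \<subseteq> {1..n}" if "x \<sigma> \<noteq> 0" "f (\<tau> - \<sigma>) \<noteq> 0" "\<sigma> \<subseteq> \<tau>" for \<sigma> \<tau>
    proof -
      have "\<sigma> \<subseteq> {1..n}" using x that(1) by (simp add: mem_carrier_ext_alg)
      moreover have "\<tau> - \<sigma> \<subseteq> {1..n}" using f that(2) sub by blast
      ultimately show ?thesis by blast
    qed
    show "x \<otimes>\<^bsub>?E\<^esub> f \<in> ?S"
    proof (clarsimp dest!: wedge_nonzeroD)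
      fix \<tau> \<sigma> assume *: "\<sigma> \<subseteq> \<tau>" "x \<sigma> \<noteq> 0" "f (\<tau> - \<sigma>) \<noteq> 0"
      have "\<tau> - \<sigma> \<in> U" using f *(3) by blast
      then show "\<tau> \<in> U" by (rule up) (use supp * in auto)
    qed
    show "f \<otimes>\<^bsub>?E\<^esub> x \<in> ?S"
    proof (clarsimp dest!: wedge_nonzeroD)
      fix \<tau> \<sigma> assume *: "\<sigma> \<subseteq> \<tau>" "f \<sigma> \<noteq> 0" "x (\<tau> - \<sigma>) \<noteq> 0"
      have "\<sigma> \<in> U" using f *(2) by blast
      then show "\<tau> \<in> U"
        by (rule up) (use supp[of "\<tau> - \<sigma>" \<tau>] * in \<open>auto simp: double_diff\<close>)
    qed
  qed
qed

lemma ideal_mon_ideal: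
  assumes "M \<subseteq> Pow {1..n}"
  shows "ideal (mon_ideal n M) (ext_alg n :: (nat set \<Rightarrow> 'k::field) ring)"
proof -
  interpret ring "ext_alg n :: (nat set \<Rightarrow> 'k) ring" by (rule ring_ext_alg)
  show ?thesis
    unfolding mon_ideal_def by (rule genideal_ideal) (use assms emon_in_carrier in blast)
qed

lemma mon_ideal_support:
  assumes M: "M \<subseteq> Pow {1..n}" and f: "f \<in> (mon_ideal n M :: (nat set \<Rightarrow> 'k::field) set)"
    and nz: "f \<tau> \<noteq> 0"
  shows "\<tau> \<in> up_closure n M"
proof -
  let ?S = "{f :: nat set \<Rightarrow> 'k. \<forall>\<tau>. f \<tau> \<noteq> 0 \<longrightarrow> \<tau> \<in> up_closure n M}"
  interpret ring "ext_alg n :: (nat set \<Rightarrow> 'k) ring" by (rule ring_ext_alg)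
  have "mon_ideal n M \<subseteq> ?S"
    unfolding mon_ideal_def
  proof (rule genideal_minimal)
    show "ideal ?S (ext_alg n)"
      by (rule ideal_supported; unfold up_closure_def; blast)
    show "emon ` M \<subseteq> ?S" using M by (auto simp: emon_def up_closure_def split: if_splits)
  qed
  then show ?thesis using f nz by blast
qed

lemma Mon_mon_ideal:
  assumes M: "M \<subseteq> Pow {1..n}"
  shows "Mon n (mon_ideal n M :: (nat set \<Rightarrow> 'k::field) set) = up_closure n M"
proof
  show "Mon n (mon_ideal n M :: (nat set \<Rightarrow> 'k) set) \<subseteq> up_closure n M"
    using mon_ideal_support[OF M] by (force simp: Mon_def emon_def)
next
  interpret ring "ext_alg n :: (nat set \<Rightarrow> 'k) ring" by (rule ring_ext_alg)
  interpret I: ideal "mon_ideal n M" "ext_alg n :: (nat set \<Rightarrow> 'k) ring"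
    by (rule ideal_mon_ideal[OF M])
  show "up_closure n M \<subseteq> Mon n (mon_ideal n M :: (nat set \<Rightarrow> 'k) set)"
  proof
    fix \<tau> assume "\<tau> \<in> up_closure n M"
    then obtain \<sigma> where \<tau>: "\<tau> \<subseteq> {1..n}" and \<sigma>: "\<sigma> \<in> M" "\<sigma> \<subseteq> \<tau>" by (auto simp: up_closure_def)
    let ?g = "\<lambda>\<rho>. wedge_sign (\<tau> - \<sigma>) \<sigma> * emon (\<tau> - \<sigma>) \<rho> :: 'k"
    have "emon ` M \<subseteq> carrier (ext_alg n :: (nat set \<Rightarrow> 'k) ring)"
      using M emon_in_carrier by blast
    then have "emon \<sigma> \<in> (mon_ideal n M :: (nat set \<Rightarrow> 'k) set)"
      unfolding mon_ideal_def using genideal_self \<sigma>(1) by blast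
    moreover have "?g \<in> carrier (ext_alg n)"
      using \<tau> by (auto simp: mem_carrier_ext_alg emon_def split: if_splits)
    ultimately have "wedge ?g (emon \<sigma>) \<in> mon_ideal n M"
      using I.I_l_closed by simp
    moreover have "finite \<tau>" using \<tau> by (rule finite_subset) simp
    then have "emon \<tau> = wedge ?g (emon \<sigma>)"
      using emon_eq_wedge[of \<tau> "\<tau> - \<sigma>"] \<sigma>(2) by (simp add: double_diff)
    ultimately show "\<tau> \<in> Mon n (mon_ideal n M :: (nat set \<Rightarrow> 'k) set)"
      using \<tau> by (simp add: Mon_def)
  qed
qed

lemma Mon_homog_part: "Mon n (homog_part S d) = degree_part d (Mon n S)"
  by (auto simp: Mon_def homog_part_def degree_part_def emon_def)

lemma Mon_E1_product:
  assumes M: "M \<subseteq> Pow {1..n}"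
  shows "Mon n (homog_part (carrier (ext_alg n)) 1 \<cdot>\<^bsub>ext_alg n\<^esub>
      homog_part (mon_ideal n M :: (nat set \<Rightarrow> 'k::field) set) d) =
    upper_shadow n (degree_part d (up_closure n M))"
    (is "Mon n (?E1 \<cdot>\<^bsub>?E\<^esub> ?J) = upper_shadow n ?A")
proof
  have supp: "f \<in> ?E1 \<cdot>\<^bsub>?E\<^esub> ?J \<Longrightarrow> \<forall>\<tau>. f \<tau> \<noteq> 0 \<longrightarrow> \<tau> \<in> upper_shadow n ?A" for f
  proof (induction f rule: ideal_prod.induct)
    case (prod f g)
    show ?case
    proof (intro allI impI)
      fix \<tau> assume "(f \<otimes>\<^bsub>?E\<^esub> g) \<tau> \<noteq> 0"
      then obtain \<sigma> where \<sigma>: "\<sigma> \<subseteq> \<tau>" "f \<sigma> \<noteq> 0" "g (\<tau> - \<sigma>) \<noteq> 0"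
        by (auto dest: wedge_nonzeroD)
      then have "card \<sigma> = 1" and s: "\<sigma> \<subseteq> {1..n}"
        using prod(1) by (auto simp: homog_part_def mem_carrier_ext_alg)
      then obtain x where x: "\<sigma> = {x}" by (auto simp: card_1_singleton_iff)
      have "\<tau> - {x} \<in> ?A"
        using prod(2) \<sigma>(3) mon_ideal_support[OF M, of g] x
        by (auto simp: homog_part_def degree_part_def)
      moreover from this have "\<tau> \<subseteq> {1..n}"
        using s x by (auto simp: degree_part_def up_closure_def)
      ultimately show "\<tau> \<in> upper_shadow n ?A"
        using \<sigma>(1) x by (auto simp: upper_shadow_def)
    qed
  next
    case (sum f g)
    show ?case
    proof (intro allI impI)
      fix \<tau> assume "(f \<oplus>\<^bsub>?E\<^esub> g) \<tau> \<noteq> 0"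
      then have "f \<tau> \<noteq> 0 \<or> g \<tau> \<noteq> 0" by auto
      then show "\<tau> \<in> upper_shadow n ?A" using sum.IH by blast
    qed
  qed
  show "Mon n (?E1 \<cdot>\<^bsub>?E\<^esub> ?J) \<subseteq> upper_shadow n ?A"
  proof
    fix \<tau> assume "\<tau> \<in> Mon n (?E1 \<cdot>\<^bsub>?E\<^esub> ?J)"
    then have "emon \<tau> \<in> ?E1 \<cdot>\<^bsub>?E\<^esub> ?J" by (simp add: Mon_def)
    from supp[OF this] show "\<tau> \<in> upper_shadow n ?A" by (simp add: emon_def)
  qed
  show "upper_shadow n ?A \<subseteq> Mon n (?E1 \<cdot>\<^bsub>?E\<^esub> ?J)"
  proof
    fix \<tau> assume "\<tau> \<in> upper_shadow n ?A"
    then obtain x where \<tau>: "\<tau> \<subseteq> {1..n}" and x: "x \<in> \<tau>" "\<tau> - {x} \<in> ?A"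
      by (auto simp: upper_shadow_def)
    let ?g = "\<lambda>\<rho>. wedge_sign {x} (\<tau> - {x}) * emon {x} \<rho> :: 'k"
    have "finite \<tau>" using \<tau> by (rule finite_subset) simp
    then have "emon \<tau> = wedge ?g (emon (\<tau> - {x}))"
      using x(1) by (intro emon_eq_wedge) auto
    moreover have "?g \<in> ?E1"
      using \<tau> x(1) by (auto simp: homog_part_def mem_carrier_ext_alg emon_def split: if_splits)
    moreover have "emon (\<tau> - {x}) \<in> ?J"
      using x(2) unfolding Mon_mon_ideal[OF M, where 'k='k, symmetric] Mon_homog_part[symmetric]
      by (simp add: Mon_def)
    ultimately have "emon \<tau> \<in> ?E1 \<cdot>\<^bsub>?E\<^esub> ?J"
      using ideal_prod.prod[of ?g ?E1 "emon (\<tau> - {x})" ?J ?E] by simp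
    then show "\<tau> \<in> Mon n (?E1 \<cdot>\<^bsub>?E\<^esub> ?J)" using \<tau> by (simp add: Mon_def)
  qed
qed

section \<open>Generators degree by degree\<close>

lemma degree_part_Suc_up_closure:
  assumes M: "M \<subseteq> Pow {1..n}"
  shows "degree_part (Suc d) (up_closure n M) =
    upper_shadow n (degree_part d (up_closure n M)) \<union> degree_part (Suc d) M" (is "?A' = ?sh \<union> ?M")
proof
  show "?A' \<subseteq> ?sh \<union> ?M"
  proof
    fix \<tau> assume \<tau>: "\<tau> \<in> ?A'"
    then obtain \<sigma> where \<sigma>: "\<sigma> \<in> M" "\<sigma> \<subseteq> \<tau>" and \<tau>n: "\<tau> \<subseteq> {1..n}" and c: "card \<tau> = Suc d"
      by (auto simp: degree_part_def up_closure_def)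
    show "\<tau> \<in> ?sh \<union> ?M"
    proof (cases "\<sigma> = \<tau>")
      case True
      then show ?thesis using \<sigma> c by (simp add: degree_part_def)
    next
      case False
      then obtain x where "x \<in> \<tau>" "x \<notin> \<sigma>" using \<sigma> by blast
      then have "x \<in> \<tau>" "\<tau> - {x} \<in> degree_part d (up_closure n M)"
        using \<sigma> \<tau>n c by (auto simp: degree_part_def up_closure_def intro!: bexI[of _ \<sigma>])
      then show ?thesis using \<tau>n by (auto simp: upper_shadow_def)
    qed
  qed
  show "?sh \<union> ?M \<subseteq> ?A'"
  proof
    fix \<tau> assume "\<tau> \<in> ?sh \<union> ?M"
    then show "\<tau> \<in> ?A'"
    proof
      assume "\<tau> \<in> ?sh"
      then obtain x where x: "\<tau> \<subseteq> {1..n}" "x \<in> \<tau>" "\<tau> - {x} \<in> degree_part d (up_closure n M)"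
        by (auto simp: upper_shadow_def)
      then obtain \<sigma> where \<sigma>: "\<sigma> \<in> M" "\<sigma> \<subseteq> \<tau>" and c: "card (\<tau> - {x}) = d"
        by (auto simp: degree_part_def up_closure_def)
      have "finite \<tau>" using x(1) by (rule finite_subset) simp
      then have "card \<tau> = Suc d" using card_Suc_Diff1[of \<tau> x] x(2) c by simp
      then show ?thesis using x(1) \<sigma> by (auto simp: degree_part_def up_closure_def)
    next
      assume "\<tau> \<in> ?M"
      then show ?thesis using M by (auto simp: degree_part_def up_closure_def)
    qed
  qed
qed

text \<open>A generator that is a proper multiple of another one could be dropped.\<close>

lemma minimal_mon_gens_antichain:
  assumes "minimal_mon_gens n (I :: (nat set \<Rightarrow> 'k::field) set) M"
    and "\<sigma> \<in> M" "\<tau> \<in> M" "\<sigma> \<subseteq> \<tau>"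
  shows "\<sigma> = \<tau>"
proof (rule ccontr)
  assume neq: "\<sigma> \<noteq> \<tau>"
  have M: "M \<subseteq> Pow {1..n}" and I: "mon_ideal n M = I"
    and min: "\<And>M'. M' \<subset> M \<Longrightarrow> mon_ideal n M' \<noteq> I"
    using assms(1) by (auto simp: minimal_mon_gens_def)
  interpret ring "ext_alg n :: (nat set \<Rightarrow> 'k) ring" by (rule ring_ext_alg)
  let ?M = "M - {\<tau>}"
  have M': "?M \<subseteq> Pow {1..n}" using M by blast
  have emon_M: "emon ` M \<subseteq> (mon_ideal n ?M :: (nat set \<Rightarrow> 'k) set)"
  proof -
    have "M \<subseteq> up_closure n ?M"
    proof
      fix \<upsilon> assume \<upsilon>: "\<upsilon> \<in> M"
      have "\<exists>\<sigma>'\<in>?M. \<sigma>' \<subseteq> \<upsilon>"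
      proof (cases "\<upsilon> = \<tau>")
        case True
        then show ?thesis using assms(2,4) neq by blast
      next
        case False
        then show ?thesis using \<upsilon> by blast
      qed
      then show "\<upsilon> \<in> up_closure n ?M" using M \<upsilon> by (auto simp: up_closure_def)
    qed
    then show ?thesis using Mon_mon_ideal[OF M', where 'k='k] by (auto simp: Mon_def)
  qed
  have "mon_ideal n M \<subseteq> (mon_ideal n ?M :: (nat set \<Rightarrow> 'k) set)"
    unfolding mon_ideal_def[of n M]
    by (rule genideal_minimal[OF ideal_mon_ideal[OF M'] emon_M])
  moreover have "mon_ideal n ?M \<subseteq> (mon_ideal n M :: (nat set \<Rightarrow> 'k) set)"
  proof -
    have "emon ` ?M \<subseteq> (mon_ideal n M :: (nat set \<Rightarrow> 'k) set)"
      using Mon_mon_ideal[OF M, where 'k='k] M by (fastforce simp: Mon_def up_closure_def)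
    then show ?thesis
      unfolding mon_ideal_def[of n ?M] by (rule genideal_minimal[OF ideal_mon_ideal[OF M]])
  qed
  ultimately show False using min[of ?M] assms(3) I by blast
qed

lemma new_gens_disjoint_upper_shadow:
  assumes anti: "\<And>\<sigma> \<tau>. \<sigma> \<in> M \<Longrightarrow> \<tau> \<in> M \<Longrightarrow> \<sigma> \<subseteq> \<tau> \<Longrightarrow> \<sigma> = \<tau>"
  shows "upper_shadow n (degree_part d (up_closure n M)) \<inter> degree_part (Suc d) M = {}"
proof (rule ccontr)
  assume "\<not> ?thesis"
  then obtain \<tau> x \<sigma> where "\<tau> \<in> M" "x \<in> \<tau>" "\<sigma> \<in> M" "\<sigma> \<subseteq> \<tau> - {x}"
    by (auto simp: upper_shadow_def degree_part_def up_closure_def)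
  then show False using anti[of \<sigma> \<tau>] by blast
qed

text \<open>
  What the construction leaves behind, in terms of its final set \<open>H\<close> of generators alone. Generators
  of degree at least \<open>d\<close> do not influence degree \<open>d - 1\<close> of the ideal, so the ideal present when
  degree \<open>d\<close> is treated can be replaced by the ideal of \<open>H\<close>.
\<close>

lemma colex_steps_largest_revlex:
  assumes "colex_steps TYPE('k::field) n p ds G H"
    and "sorted ds" "distinct ds" "0 \<notin> set ds" "G \<subseteq> Pow {1..n}"
    and "\<And>\<sigma> d. \<sigma> \<in> G \<Longrightarrow> d \<in> set ds \<Longrightarrow> card \<sigma> < d"
  shows "H \<subseteq> Pow {1..n} \<and> {\<sigma> \<in> H. card \<sigma> \<notin> set ds} = G \<and>
    (\<forall>d. Suc d \<in> set ds \<longrightarrow> largest_revlex (p (Suc d))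
      (Mon_deg n (Suc d) - upper_shadow n (degree_part d (up_closure n H)))
      (degree_part (Suc d) H))"
  using assms
proof (induction ds arbitrary: G)
  case Nil
  then show ?case by simp
next
  case (Cons d ds)
  from Cons.prems(4) obtain c where d: "d = Suc c" by (cases d) auto
  let ?A = "Mon_deg n d - upper_shadow n (degree_part c (up_closure n G))"
  have "\<exists>L. largest_revlex (p d) ?A L \<and> colex_steps TYPE('k) n p ds (G \<union> L) H"
    using Cons.prems(1) Mon_E1_product[OF Cons.prems(5), of c, where 'k='k]
    by (simp add: Let_def d)
  then obtain L where L: "largest_revlex (p d) ?A L"
    and steps: "colex_steps TYPE('k) n p ds (G \<union> L) H" by blast
  have gt: "\<forall>e\<in>set ds. d < e" using Cons.prems(2,3) by (auto simp: order_less_le)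
  have LA: "L \<subseteq> Mon_deg n d" using L by (auto simp: largest_revlex_def)
  have "sorted ds" "distinct ds" "0 \<notin> set ds" using Cons.prems(2-4) by auto
  moreover have "G \<union> L \<subseteq> Pow {1..n}" using Cons.prems(5) LA by (auto simp: Mon_deg_def)
  moreover have "card \<sigma> < e" if "\<sigma> \<in> G \<union> L" "e \<in> set ds" for \<sigma> e
    using that Cons.prems(6)[of \<sigma> e] gt LA by (auto simp: Mon_deg_def)
  ultimately have "H \<subseteq> Pow {1..n} \<and> {\<sigma> \<in> H. card \<sigma> \<notin> set ds} = G \<union> L \<and>
    (\<forall>d. Suc d \<in> set ds \<longrightarrow> largest_revlex (p (Suc d))
      (Mon_deg n (Suc d) - upper_shadow n (degree_part d (up_closure n H)))
      (degree_part (Suc d) H))"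
    by (rule Cons.IH[OF steps])
  then have IH: "H \<subseteq> Pow {1..n}" "{\<sigma> \<in> H. card \<sigma> \<notin> set ds} = G \<union> L"
    "\<forall>d. Suc d \<in> set ds \<longrightarrow> largest_revlex (p (Suc d))
      (Mon_deg n (Suc d) - upper_shadow n (degree_part d (up_closure n H)))
      (degree_part (Suc d) H)"
    by blast+
  have G: "card \<sigma> < d" if "\<sigma> \<in> G" for \<sigma> using Cons.prems(6) that by simp
  have L_eq: "degree_part d H = L"
    using IH(2) G LA gt unfolding degree_part_def Mon_deg_def by fastforce
  have G_eq: "{\<sigma> \<in> H. card \<sigma> \<notin> set (d # ds)} = G"
    using IH(2) G LA gt unfolding Mon_deg_def by fastforce
  have "degree_part c (up_closure n G) = degree_part c (up_closure n H)"
  proof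
    show "degree_part c (up_closure n G) \<subseteq> degree_part c (up_closure n H)"
      using G_eq by (auto simp: degree_part_def up_closure_def)
    show "degree_part c (up_closure n H) \<subseteq> degree_part c (up_closure n G)"
    proof
      fix \<tau> assume "\<tau> \<in> degree_part c (up_closure n H)"
      then obtain \<sigma> where \<sigma>: "\<sigma> \<in> H" "\<sigma> \<subseteq> \<tau>" and \<tau>: "\<tau> \<subseteq> {1..n}" "card \<tau> = c"
        by (auto simp: degree_part_def up_closure_def)
      have "card \<sigma> \<le> c" using card_mono[OF finite_subset[OF \<tau>(1)] \<sigma>(2)] \<tau>(2) by simp
      then have "card \<sigma> \<notin> set (d # ds)" using gt d by fastforce
      then have "\<sigma> \<in> G" using G_eq \<sigma>(1) by blast
      then show "\<tau> \<in> degree_part c (up_closure n G)"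
        using \<sigma>(2) \<tau> by (auto simp: degree_part_def up_closure_def)
    qed
  qed
  then have "largest_revlex (p (Suc c))
      (Mon_deg n (Suc c) - upper_shadow n (degree_part c (up_closure n H)))
      (degree_part (Suc c) H)"
    using L L_eq d by simp
  then show ?case using IH(1,3) G_eq d by auto
qed

section \<open>Counting monomials in the first variables\<close>

text \<open>
  The condition \<open>\<sigma> \<subseteq> {1..p}\<close> stands for \<open>m(e\<^sub>\<sigma>) \<le> p\<close>; unlike \<open>Max \<sigma> \<le> p\<close> it also makes sense for
  \<open>\<sigma> = {}\<close>.
\<close>

definition count_below :: "nat \<Rightarrow> nat set set \<Rightarrow> nat" where
  "count_below p A = card {\<sigma> \<in> A. \<sigma> \<subseteq> {1..p}}"

definition shifted :: "nat set set \<Rightarrow> bool" where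
  "shifted A \<longleftrightarrow> (\<forall>\<sigma>\<in>A. \<forall>j\<in>\<sigma>. \<forall>i\<in>{1..<j}. i \<notin> \<sigma> \<longrightarrow> insert i (\<sigma> - {j}) \<in> A)"

lemma finite_below [simp]: "finite {\<sigma> \<in> A. \<sigma> \<subseteq> {1..p::nat}}"
  by (rule finite_subset[of _ "Pow {1..p}"]) auto

lemma m_le_eq_count_below:
  assumes "A \<subseteq> Pow {1..n}" "{} \<notin> A"
  shows "m_le p A = count_below p A"
proof -
  have "Max \<sigma> \<le> p \<longleftrightarrow> \<sigma> \<subseteq> {1..p}" if "\<sigma> \<in> A" for \<sigma>
  proof -
    have "\<sigma> \<subseteq> {1..n}" "\<sigma> \<noteq> {}" using that assms by auto
    moreover from this have "finite \<sigma>" by (auto intro: finite_subset)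
    ultimately show ?thesis by auto
  qed
  then show ?thesis unfolding m_le_def count_below_def by (auto intro: arg_cong[where f=card])
qed

lemma count_below_mono: "A \<subseteq> B \<Longrightarrow> count_below p A \<le> count_below p B"
  unfolding count_below_def by (rule card_mono) auto

lemma count_below_Un_disjoint:
  assumes "A \<inter> B = {}"
  shows "count_below p (A \<union> B) = count_below p A + count_below p B"
proof -
  have "{\<sigma> \<in> A \<union> B. \<sigma> \<subseteq> {1..p}} = {\<sigma> \<in> A. \<sigma> \<subseteq> {1..p}} \<union> {\<sigma> \<in> B. \<sigma> \<subseteq> {1..p}}" by blast
  then show ?thesis
    unfolding count_below_def using assms by (simp add: card_Un_disjoint disjoint_iff)
qed

lemma card_insert_above:
  "card (insert (Suc p) ` {\<sigma> \<in> A. \<sigma> \<subseteq> {1..p}}) = count_below p A"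
  unfolding count_below_def
proof (rule card_image, rule inj_onI)
  fix \<sigma> \<tau> assume "\<sigma> \<in> {\<sigma> \<in> A. \<sigma> \<subseteq> {1..p}}" "\<tau> \<in> {\<sigma> \<in> A. \<sigma> \<subseteq> {1..p}}"
    "insert (Suc p) \<sigma> = insert (Suc p) \<tau>"
  moreover from this have "Suc p \<notin> \<sigma>" "Suc p \<notin> \<tau>" by auto
  ultimately show "\<sigma> = \<tau>" by (metis insert_ident)
qed

lemma count_below_Suc:
  "count_below (Suc p) A = count_below p A + card {\<sigma> \<in> A. \<sigma> \<subseteq> {1..Suc p} \<and> Suc p \<in> \<sigma>}"
proof -
  have "{\<sigma> \<in> A. \<sigma> \<subseteq> {1..Suc p}} =
      {\<sigma> \<in> A. \<sigma> \<subseteq> {1..p}} \<union> {\<sigma> \<in> A. \<sigma> \<subseteq> {1..Suc p} \<and> Suc p \<in> \<sigma>}"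
    by (auto simp: subset_iff le_Suc_eq)
  moreover have "finite {\<sigma> \<in> A. \<sigma> \<subseteq> {1..Suc p} \<and> Suc p \<in> \<sigma>}"
    by (rule finite_subset[OF _ finite_below[of A "Suc p"]]) auto
  ultimately show ?thesis
    unfolding count_below_def by (simp, subst card_Un_disjoint) auto
qed

lemma count_below_Suc_upper_shadow_ge:
  assumes "Suc p \<le> n"
  shows "count_below (Suc p) (upper_shadow n A) \<ge>
    count_below p (upper_shadow n A) + count_below p A"
proof -
  have "insert (Suc p) ` {\<sigma> \<in> A. \<sigma> \<subseteq> {1..p}} \<subseteq>
      {\<tau> \<in> upper_shadow n A. \<tau> \<subseteq> {1..Suc p} \<and> Suc p \<in> \<tau>}"
  proof clarify
    fix \<sigma> assume \<sigma>: "\<sigma> \<in> A" "\<sigma> \<subseteq> {1..p}"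
    then have "Suc p \<notin> \<sigma>" by auto
    moreover have "insert (Suc p) \<sigma> \<subseteq> {1..Suc p}" using \<sigma>(2) by auto
    moreover from this have "insert (Suc p) \<sigma> \<subseteq> {1..n}" using assms by auto
    ultimately show "insert (Suc p) \<sigma> \<in> upper_shadow n A \<and>
        insert (Suc p) \<sigma> \<subseteq> {1..Suc p} \<and> Suc p \<in> insert (Suc p) \<sigma>"
      using \<sigma>(1) by (auto simp: upper_shadow_def)
  qed
  moreover have "finite {\<tau> \<in> upper_shadow n A. \<tau> \<subseteq> {1..Suc p} \<and> Suc p \<in> \<tau>}"
    by (rule finite_subset[OF _ finite_below[of "upper_shadow n A" "Suc p"]]) auto
  ultimately have "card (insert (Suc p) ` {\<sigma> \<in> A. \<sigma> \<subseteq> {1..p}}) \<le>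
      card {\<tau> \<in> upper_shadow n A. \<tau> \<subseteq> {1..Suc p} \<and> Suc p \<in> \<tau>}"
    by (rule card_mono[rotated])
  then show ?thesis by (simp only: card_insert_above count_below_Suc)
qed

text \<open>
  Strong stability gives the reverse inequality: if \<open>\<tau> = \<sigma> \<union> {x}\<close> has maximum \<open>p + 1 > x\<close> and \<open>\<sigma>\<close> is
  in the family, then so is \<open>\<tau> - {p + 1}\<close>, which arises from \<open>\<sigma>\<close> by replacing \<open>p + 1\<close> by \<open>x\<close>.
\<close>

lemma count_below_Suc_upper_shadow_le:
  assumes "shifted A"
  shows "count_below (Suc p) (upper_shadow n A) \<le>
    count_below p (upper_shadow n A) + count_below p A"
proof -
  have "{\<tau> \<in> upper_shadow n A. \<tau> \<subseteq> {1..Suc p} \<and> Suc p \<in> \<tau>} \<subseteq>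
      insert (Suc p) ` {\<sigma> \<in> A. \<sigma> \<subseteq> {1..p}}"
  proof clarify
    fix \<tau> assume \<tau>: "\<tau> \<in> upper_shadow n A" "\<tau> \<subseteq> {1..Suc p}" "Suc p \<in> \<tau>"
    then obtain x where x: "x \<in> \<tau>" "\<tau> - {x} \<in> A" by (auto simp: upper_shadow_def)
    have "\<tau> - {Suc p} \<in> A"
    proof (cases "x = Suc p")
      case True
      then show ?thesis using x by simp
    next
      case False
      then have "Suc p \<in> \<tau> - {x}" "x \<in> {1..<Suc p}" using x \<tau> by (auto simp: subset_iff)
      moreover have "x \<notin> \<tau> - {x}" by simp
      ultimately have "insert x (\<tau> - {x} - {Suc p}) \<in> A"
        using assms x(2) unfolding shifted_def by blast
      moreover have "insert x (\<tau> - {x} - {Suc p}) = \<tau> - {Suc p}" using x False by auto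
      ultimately show ?thesis by simp
    qed
    moreover have "\<tau> - {Suc p} \<subseteq> {1..p}" using \<tau>(2) by (auto simp: subset_iff le_Suc_eq)
    ultimately show "\<tau> \<in> insert (Suc p) ` {\<sigma> \<in> A. \<sigma> \<subseteq> {1..p}}"
      using \<tau>(3) by (intro image_eqI[of _ _ "\<tau> - {Suc p}"]) auto
  qed
  then have "card {\<tau> \<in> upper_shadow n A. \<tau> \<subseteq> {1..Suc p} \<and> Suc p \<in> \<tau>} \<le>
      card (insert (Suc p) ` {\<sigma> \<in> A. \<sigma> \<subseteq> {1..p}})"
    by (rule card_mono[rotated]) simp
  then show ?thesis by (simp only: card_insert_above count_below_Suc)
qed

lemma count_below_upper_shadow_mono:
  assumes "shifted A" and "\<And>q. q \<le> n \<Longrightarrow> count_below q A \<le> count_below q B" and "p \<le> n"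
  shows "count_below p (upper_shadow n A) \<le> count_below p (upper_shadow n B)"
  using assms(3)
proof (induction p)
  case 0
  \<comment> \<open>The empty set is in no upper shadow.\<close>
  have "{\<tau> \<in> upper_shadow n A. \<tau> \<subseteq> {1..0}} = {}" by (auto simp: upper_shadow_def)
  then show ?case unfolding count_below_def by (metis card.empty le0)
next
  case (Suc p)
  then show ?case
    using count_below_Suc_upper_shadow_le[OF assms(1), of p n]
      count_below_Suc_upper_shadow_ge[of p n B] assms(2)[of p] by linarith
qed

section \<open>Generators that are largest in the reverse lexicographic order\<close>

text \<open>
  The comparison starts at the largest index, so a monomial with a variable beyond \<open>p\<close> is below
  every monomial in the variables up to \<open>p\<close>.
\<close>

lemma not_revlex_gt_if_below:
  assumes "finite \<tau>" "\<not> \<tau> \<subseteq> {1..p}" "0 \<notin> \<tau>" "\<sigma> \<subseteq> {1..p}"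
  shows "\<not> revlex_gt \<tau> \<sigma>"
proof
  define xs where "xs = sorted_list_of_set \<tau>"
  define ys where "ys = sorted_list_of_set \<sigma>"
  assume "revlex_gt \<tau> \<sigma>"
  then obtain s where len: "length xs = length ys" and s: "s < length xs"
    "\<forall>k. s < k \<and> k < length xs \<longrightarrow> xs ! k = ys ! k" "xs ! s < ys ! s"
    by (auto simp: revlex_gt_def Let_def xs_def ys_def)
  have fin: "finite \<sigma>" using assms(4) by (rule finite_subset) simp
  obtain x where "x \<in> \<tau>" "x > p"
    using assms(2,3) by (metis One_nat_def Suc_leI atLeastAtMost_iff gr0I not_le subsetI)
  then obtain k where k: "k < length xs" "xs ! k > p"
    using assms(1) by (metis in_set_conv_nth set_sorted_list_of_set xs_def)
  let ?l = "length xs - 1"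
  have "xs ! k \<le> xs ! ?l"
    by (rule sorted_nth_mono) (use k xs_def in auto)
  moreover have "ys ! ?l \<in> set ys" by (rule nth_mem) (use s(1) len in auto)
  then have "ys ! ?l \<le> p" using assms(4) fin by (auto simp: ys_def)
  moreover have "xs ! ?l \<le> ys ! ?l"
  proof (cases "s = ?l")
    case True
    then show ?thesis using s(3) by simp
  next
    case False
    then have "s < ?l" "?l < length xs" using s(1) by auto
    then show ?thesis using s(2) by simp
  qed
  ultimately show False using k(2) by simp
qed

text \<open>
  One degree of the comparison: \<open>SA\<close> and \<open>S\<close> play the shadows, \<open>P\<close> and \<open>L\<close> the new generators.
  Either \<open>L\<close> lies in the variables up to \<open>p\<close> and the counts add up, or \<open>L\<close> reaches beyond \<open>p\<close> and
  then \<open>S \<union> L\<close> exhausts the monomials of degree \<open>d\<close> in the variables up to \<open>p\<close>.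
\<close>

lemma count_below_largest_revlex:
  assumes L: "largest_revlex r (Mon_deg n d - S) L" and "p \<le> n"
    and S: "A \<subseteq> Mon_deg n d" "A = SA \<union> P" "count_below p SA \<le> count_below p S"
    and P: "SA \<inter> P = {}" "finite P" "card P = r"
  shows "count_below p A \<le> count_below p (S \<union> L)"
proof (cases "L \<subseteq> Pow {1..p}")
  case True
  have "count_below p P \<le> card P"
    unfolding count_below_def by (rule card_mono) (use P in auto)
  moreover have "{\<sigma> \<in> L. \<sigma> \<subseteq> {1..p}} = L" using True by auto
  then have "count_below p L = card P"
    unfolding count_below_def using L P by (simp add: largest_revlex_def)
  moreover have "S \<inter> L = {}" using L by (auto simp: largest_revlex_def)
  ultimately show ?thesis
    using S P by (simp add: count_below_Un_disjoint)
next
  case False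
  then obtain \<tau> where \<tau>: "\<tau> \<in> L" "\<not> \<tau> \<subseteq> {1..p}" by blast
  then have "\<tau> \<subseteq> {1..n}" using L by (auto simp: largest_revlex_def Mon_deg_def)
  then have \<tau>': "finite \<tau>" "0 \<notin> \<tau>" by (auto intro: finite_subset)
  have "\<sigma> \<in> S \<union> L" if "\<sigma> \<in> A" "\<sigma> \<subseteq> {1..p}" for \<sigma>
  proof (rule ccontr)
    assume "\<sigma> \<notin> S \<union> L"
    then have "revlex_gt \<tau> \<sigma>"
      using L \<tau>(1) S(1) that(1) by (auto simp: largest_revlex_def)
    then show False using not_revlex_gt_if_below[OF \<tau>'(1) \<tau>(2) \<tau>'(2) that(2)] by simp
  qed
  then show ?thesis unfolding count_below_def by (intro card_mono) auto
qed

section \<open>The comparison theorem\<close>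

lemma shifted_degree_part:
  assumes "shifted A" "A \<subseteq> Pow {1..n}"
  shows "shifted (degree_part d A)"
  unfolding shifted_def
proof (intro ballI impI)
  fix \<sigma> i j assume *: "\<sigma> \<in> degree_part d A" "j \<in> \<sigma>" "i \<in> {1..<j}" "i \<notin> \<sigma>"
  then have "insert i (\<sigma> - {j}) \<in> A"
    using assms(1) by (auto simp: shifted_def degree_part_def)
  moreover have "finite \<sigma>" using * assms(2) by (auto simp: degree_part_def intro: finite_subset)
  then have "card (insert i (\<sigma> - {j})) = card \<sigma>"
    using *(2,4) card_Suc_Diff1[of \<sigma> j] by simp
  ultimately show "insert i (\<sigma> - {j}) \<in> degree_part d A"
    using *(1) by (simp add: degree_part_def)
qed

lemma shifted_Mon_strongly_stable:
  assumes "strongly_stable n (I :: (nat set \<Rightarrow> 'k::field) set)"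
  shows "shifted (Mon n I)"
  unfolding shifted_def
proof (intro ballI impI)
  fix \<sigma> i j assume *: "\<sigma> \<in> Mon n I" "j \<in> \<sigma>" "i \<in> {1..<j}" "i \<notin> \<sigma>"
  let ?f = "wedge (emon {i}) (emon (\<sigma> - {j})) :: nat set \<Rightarrow> 'k"
  have "?f \<in> I"
    using assms * by (auto simp: strongly_stable_def)
  moreover have "finite \<sigma>" using *(1) by (auto simp: Mon_def intro: finite_subset)
  then have "?f (insert i (\<sigma> - {j})) \<noteq> 0"
    using *(4) by (subst wedge_emon) (auto simp: emon_def wedge_sign_def)
  moreover obtain M where "M \<subseteq> Pow {1..n}" "I = mon_ideal n M"
    using assms by (auto simp: strongly_stable_def is_monomial_ideal_def)
  ultimately show "insert i (\<sigma> - {j}) \<in> Mon n I"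
    using mon_ideal_support[of M n ?f] Mon_mon_ideal[of M n] by metis
qed

theorem theorem4p5:
  fixes n t p :: nat and I J :: "(nat set \<Rightarrow> 'k::field) set"
  assumes "strongly_stable n I"
    and "I \<noteq> {\<zero>\<^bsub>ext_alg n\<^esub>}"
    and "I \<noteq> carrier (ext_alg n)"
    and "colexsegment_ideal n I J"
    and "indeg I \<le> t" and "t \<le> p" and "p \<le> n"
  shows "m_le p (Mon n (homog_part I t)) \<le> m_le p (Mon n (homog_part J t))"
proof -
  obtain M H where gens: "minimal_mon_gens n I M"
    and steps: "colex_steps TYPE('k) n (\<lambda>d. card {\<sigma> \<in> M. card \<sigma> = d})
         (sorted_list_of_set (card ` M)) {} H"
    and J: "J = mon_ideal n H"
    using assms(4) by (auto simp: colexsegment_ideal_def)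
  have M: "M \<subseteq> Pow {1..n}" and I: "I = mon_ideal n M"
    using gens by (auto simp: minimal_mon_gens_def)
  have "finite M" using M by (rule finite_subset) simp
  define A where "A = (\<lambda>d. degree_part d (up_closure n M))"
  define B where "B = (\<lambda>d. degree_part d (up_closure n H))"
  have MonI: "Mon n I = up_closure n M" unfolding I by (rule Mon_mon_ideal[OF M])

  \<comment> \<open>Since \<open>I\<close> is proper, it does not contain the monomial 1 of degree 0.\<close>
  interpret idI: ideal I "ext_alg n :: (nat set \<Rightarrow> 'k) ring"
    unfolding I by (rule ideal_mon_ideal[OF M])
  have "{} \<notin> Mon n I"
    using idI.one_imp_carrier assms(3) by (auto simp: Mon_def)
  then have "{} \<notin> M" using MonI by (auto simp: up_closure_def)
  have "0 \<notin> card ` M"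
  proof
    assume "0 \<in> card ` M"
    then obtain \<sigma> where \<sigma>: "\<sigma> \<in> M" "card \<sigma> = 0" by auto
    moreover from this have "finite \<sigma>" using M by (auto intro: finite_subset)
    ultimately show False using \<open>{} \<notin> M\<close> by simp
  qed

  have "H \<subseteq> Pow {1..n} \<and> {\<sigma> \<in> H. card \<sigma> \<notin> card ` M} = {} \<and>
    (\<forall>d. Suc d \<in> card ` M \<longrightarrow> largest_revlex (card {\<sigma> \<in> M. card \<sigma> = Suc d})
      (Mon_deg n (Suc d) - upper_shadow n (degree_part d (up_closure n H)))
      (degree_part (Suc d) H))"
    using colex_steps_largest_revlex[OF steps] \<open>0 \<notin> card ` M\<close> \<open>finite M\<close> by simp
  then have H: "H \<subseteq> Pow {1..n}" and Hdeg: "\<And>\<sigma>. \<sigma> \<in> H \<Longrightarrow> card \<sigma> \<in> card ` M"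
    and large: "\<And>d. Suc d \<in> card ` M \<Longrightarrow>
      largest_revlex (card (degree_part (Suc d) M))
        (Mon_deg n (Suc d) - upper_shadow n (B d)) (degree_part (Suc d) H)"
    by (auto simp: degree_part_def B_def)
  have MonJ: "Mon n J = up_closure n H" unfolding J by (rule Mon_mon_ideal[OF H])
  have "{} \<notin> H" using Hdeg[of "{}"] \<open>0 \<notin> card ` M\<close> by auto

  have A_Suc: "A (Suc d) = upper_shadow n (A d) \<union> degree_part (Suc d) M" for d
    unfolding A_def by (rule degree_part_Suc_up_closure[OF M])
  have A_disj: "upper_shadow n (A d) \<inter> degree_part (Suc d) M = {}" for d
    unfolding A_def
    by (rule new_gens_disjoint_upper_shadow) (rule minimal_mon_gens_antichain[OF gens])
  have B_Suc: "B (Suc d) = upper_shadow n (B d) \<union> degree_part (Suc d) H" for d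
    unfolding B_def by (rule degree_part_Suc_up_closure[OF H])
  have A_shifted: "shifted (A d)" for d
    using shifted_Mon_strongly_stable[OF assms(1)]
    unfolding A_def MonI by (rule shifted_degree_part) (auto simp: up_closure_def)

  have main: "count_below q (A d) \<le> count_below q (B d)" if "q \<le> n" for q d
    using that
  proof (induction d arbitrary: q)
    case 0
    have "A 0 = {}"
      using \<open>{} \<notin> Mon n I\<close> unfolding MonI A_def degree_part_def
      by (auto simp: up_closure_def dest: finite_subset)
    then show ?case by (simp add: count_below_def)
  next
    case (Suc d)
    have sh: "count_below q (upper_shadow n (A d)) \<le> count_below q (upper_shadow n (B d))"
      by (rule count_below_upper_shadow_mono[OF A_shifted Suc.IH Suc.prems])
    show ?case
    proof (cases "Suc d \<in> card ` M")
      case True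
      have "A (Suc d) \<subseteq> Mon_deg n (Suc d)"
        by (auto simp: A_def degree_part_def up_closure_def Mon_deg_def)
      moreover have "finite (degree_part (Suc d) M)"
        using \<open>finite M\<close> by (simp add: degree_part_def)
      ultimately show ?thesis
        unfolding B_Suc
        using count_below_largest_revlex[OF large[OF True] Suc.prems _ A_Suc sh A_disj] by simp
    next
      case False
      then have "degree_part (Suc d) M = {}" by (force simp: degree_part_def)
      then have "count_below q (A (Suc d)) = count_below q (upper_shadow n (A d))"
        by (simp add: A_Suc)
      also note sh
      also have "count_below q (upper_shadow n (B d)) \<le> count_below q (B (Suc d))"
        unfolding B_Suc by (rule count_below_mono) simp
      finally show ?thesis .
    qed
  qed

  have "m_le p (A t) = count_below p (A t)" "m_le p (B t) = count_below p (B t)"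
    by (rule m_le_eq_count_below[of _ n];
        use \<open>{} \<notin> M\<close> \<open>{} \<notin> H\<close> in \<open>auto simp: A_def B_def degree_part_def up_closure_def\<close>)+
  then show ?thesis
    using main[OF assms(7), of t] unfolding Mon_homog_part MonI MonJ A_def B_def by simp
qed

end
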